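(* Let $b>1$ be fixed, $p=b\log N/N$, and consider majority dynamics with independently resampled update graphs $G_t\sim\mathbb G(N,p)$ started from a deterministic configuration $y_0$. Fix $K>K_2^{\mathrm{ER}}(b)$, and let $c_1,C_2,c,\xi>0$ be constants, depending only on $b$ and $K$, having properties (A) and (B) of the context. For $s\ge0$ put $$\eta_N(s)=8\exp\Bigl(-c\frac{s^2\log N}{N}\Bigr)+2\exp\bigl(-(\log N)^2\bigr)+2N^{-\xi},$$ and for $\Delta_0>0$ put $$\underline T=\max\Bigl\{0,\Bigl\lfloor\frac{\log\bigl(KN/(\Delta_0\sqrt{\log N})\bigr)}{\log(C_2\sqrt{\log N})}\Bigr\rfloor\Bigr\},\qquad \overline T=\max\Bigl\{0,\Bigl\lceil\frac{\log\bigl(KN/(\Delta_0\sqrt{\log N})\bigr)}{\log(c_1\sqrt{\log N})}\Bigr\rceil\Bigr\}.$$ Let $(h_N)$ be a sequence with $1\le h_N=o(\sqrt{\log N})$, and suppose that $R_0\ne\emptyset$ and $\Delta_0\ge\sqrt N/h_N$. Then, for all sufficiently large $N$, $$\mathbb P\bigl(\underline T+1\le\tau_{\mathrm B}\le\overline T+2\,\big|\,y_0\bigr)\ge1-\eta_N(\Delta_0),$$ where $\tau_{\mathrm B}=\inf\{t\ge0:R_t=\emptyset\}$ (with $\inf\emptyset=\infty$).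
   Context: Majority dynamics with resampling: the vertex set is $[N]=\{1,\dots,N\}$; $y_t\in\{\pm1\}^{[N]}$ is the configuration at day $t$ ($+1$ = blue, $-1$ = red), $B_t=\{v:y_t(v)=+1\}$, $R_t=\{v:y_t(v)=-1\}$, $\Delta_t=|B_t|-|R_t|$. The graphs $G_1,G_2,\dots$ are i.i.d. Erdős–Rényi graphs $\mathbb G(N,p)$ on $[N]$, independent of the fixed initial configuration $y_0$. At day $t+1$ all vertices update synchronously: if in $G_{t+1}$ the vertex $v$ has strictly more neighbors in $B_t$ than in $R_t$ then $y_{t+1}(v)=+1$; if strictly fewer then $y_{t+1}(v)=-1$; if equal then $y_{t+1}(v)=y_t(v)$. Logarithms are natural; $\Phi$ is the standard normal distribution function. Constants: $r_*=\frac12\bigl(1-\frac{\sqrt{2b-1}}{b}\bigr)$ and $K_2^{\mathrm{ER}}(b)=\frac1{\sqrt b}\Phi^{-1}(1-r_* )$. Property (A) (stepwise amplification): whenever $\sqrt{N/\log N}\le\Delta_t\le KN/\sqrt{\log N}$, $$\mathbb P\bigl(c_1\sqrt{\log N}\,\Delta_t\le\Delta_{t+1}\le C_2\sqrt{\log N}\,\Delta_t\,\big|\,y_t\bigr)\ge1-2\exp\Bigl(-c\frac{\Delta_t^2\log N}{N}\Bigr).$$ Property (B) (two-day unanimity): for all sufficiently large $N$ and every initial configuration with $\Delta_0\ge KN/\sqrt{\log N}$, $\mathbb P(R_2=\emptyset\mid y_0)\ge1-2\exp(-(\log N)^2)-2N^{-\xi}$. Constants depending only on $(b,K)$ with properties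 (A) and (B) exist (these are separate results of the same paper). "Sufficiently large $N$" may depend on $b$, $K$, the constants and the sequence $(h_N)$, but not on the particular configuration $y_0$ satisfying the hypotheses. *)

theory Defs
  imports
    "HOL-Probability.Probability"
    "HOL-Library.Ramsey"
    "HOL-Library.Landau_Symbols"
    "HOL-Library.Extended_Nat"
begin

text \<open>A graph on \<open>{1..N}\<close> is given by its edge set, a set of two-element subsets.\<close>

type_synonym graph = "nat set set"

definition configs :: "nat \<Rightarrow> (nat \<Rightarrow> int) set" where
  "configs N = {1..N} \<rightarrow>\<^sub>E {-1, 1}"

definition blue :: "nat \<Rightarrow> (nat \<Rightarrow> int) \<Rightarrow> nat set" where
  "blue N y = {v \<in> {1..N}. y v = 1}"

definition red :: "nat \<Rightarrow> (nat \<Rightarrow> int) \<Rightarrow> nat set" where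
  "red N y = {v \<in> {1..N}. y v = -1}"

definition bias :: "nat \<Rightarrow> (nat \<Rightarrow> int) \<Rightarrow> real" where
  "bias N y = real (card (blue N y)) - real (card (red N y))"

definition neighbors :: "graph \<Rightarrow> nat \<Rightarrow> nat set" where
  "neighbors G v = {u. {u, v} \<in> G}"

definition erdos_renyi :: "nat \<Rightarrow> real \<Rightarrow> graph pmf" where
  "erdos_renyi N p =
     map_pmf (\<lambda>f. {e \<in> nsets {1..N} 2. f e})
       (Pi_pmf (nsets {1..N} 2) False (\<lambda>_. bernoulli_pmf p))"

text \<open>
  The sample space carries i.i.d. graphs; the coordinate \<open>\<omega> t\<close> is the graph
  \<open>G\<^sub>t\<^sub>+\<^sub>1\<close> that is used to pass from day \<open>t\<close> to day \<open>t + 1\<close>.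
  For \<open>p = b log N / N\<close> to exceed 1, \<open>N\<close> has to be small; \<open>bernoulli_pmf\<close> then truncates
  the parameter, which has no effect on statements about all large \<open>N\<close>.
\<close>

definition graph_seq :: "nat \<Rightarrow> real \<Rightarrow> (nat \<Rightarrow> graph) measure" where
  "graph_seq N b = (\<Pi>\<^sub>M t\<in>UNIV. measure_pmf (erdos_renyi N (b * ln (real N) / real N)))"

definition update :: "nat \<Rightarrow> graph \<Rightarrow> (nat \<Rightarrow> int) \<Rightarrow> (nat \<Rightarrow> int)" where
  "update N G y = (\<lambda>v\<in>{1..N}.
     (let nb = card (neighbors G v \<inter> blue N y);
          nr = card (neighbors G v \<inter> red N y)
      in if nb > nr then 1 else if nb < nr then -1 else y v))"

primrec config :: "nat \<Rightarrow> (nat \<Rightarrow> int) \<Rightarrow> (nat \<Rightarrow> graph) \<Rightarrow> nat \<Rightarrow> (nat \<Rightarrow> int)" where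
  "config N y\<^sub>0 \<omega> 0 = y\<^sub>0"
| "config N y\<^sub>0 \<omega> (Suc t) = update N (\<omega> t) (config N y\<^sub>0 \<omega> t)"

text \<open>On \<open>enat\<close> the infimum of the empty set is \<open>\<infinity>\<close>.\<close>

definition blue_time :: "nat \<Rightarrow> (nat \<Rightarrow> int) \<Rightarrow> (nat \<Rightarrow> graph) \<Rightarrow> enat" where
  "blue_time N y\<^sub>0 \<omega> = Inf {enat t |t. red N (config N y\<^sub>0 \<omega> t) = {}}"

definition Phi :: "real \<Rightarrow> real" where
  "Phi = cdf std_normal_distribution"

text \<open>
  \<open>Phi\<close> is injective with range \<open>{0<..<1}\<close>, so \<open>inv Phi\<close> is the quantile function there;
  for \<open>b > 1\<close> it is only applied at a point of \<open>{1/2<..<1}\<close>.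
\<close>

definition r_star :: "real \<Rightarrow> real" where
  "r_star b = 1/2 * (1 - sqrt (2 * b - 1) / b)"

definition K2_ER :: "real \<Rightarrow> real" where
  "K2_ER b = 1 / sqrt b * inv Phi (1 - r_star b)"

text \<open>
  Conditioning on \<open>y\<^sub>t\<close> means conditioning on \<open>y\<^sub>t = y\<close>, for every value \<open>y\<close> that is attained
  with positive probability.
\<close>

definition stepwise_amplification ::
  "real \<Rightarrow> real \<Rightarrow> real \<Rightarrow> real \<Rightarrow> real \<Rightarrow> bool" where
  "stepwise_amplification b K c\<^sub>1 C\<^sub>2 c \<longleftrightarrow>
    (\<forall>\<^sub>F N in sequentially. \<forall>y\<^sub>0 \<in> configs N. \<forall>t. \<forall>y \<in> configs N.
       \<P>(\<omega> in graph_seq N b. config N y\<^sub>0 \<omega> t = y) > 0 \<longrightarrow>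
       sqrt (real N / ln (real N)) \<le> bias N y \<longrightarrow>
       bias N y \<le> K * real N / sqrt (ln (real N)) \<longrightarrow>
       \<P>(\<omega> in graph_seq N b.
           c\<^sub>1 * sqrt (ln (real N)) * bias N (config N y\<^sub>0 \<omega> t) \<le> bias N (config N y\<^sub>0 \<omega> (t + 1)) \<and>
           bias N (config N y\<^sub>0 \<omega> (t + 1)) \<le> C\<^sub>2 * sqrt (ln (real N)) * bias N (config N y\<^sub>0 \<omega> t)
         \<bar> config N y\<^sub>0 \<omega> t = y)
       \<ge> 1 - 2 * exp (- c * ((bias N y)\<^sup>2 * ln (real N) / real N)))"

definition two_day_unanimity :: "real \<Rightarrow> real \<Rightarrow> real \<Rightarrow> bool" where
  "two_day_unanimity b K \<xi> \<longleftrightarrow>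
    (\<forall>\<^sub>F N in sequentially. \<forall>y\<^sub>0 \<in> configs N.
       bias N y\<^sub>0 \<ge> K * real N / sqrt (ln (real N)) \<longrightarrow>
       \<P>(\<omega> in graph_seq N b. red N (config N y\<^sub>0 \<omega> 2) = {})
       \<ge> 1 - 2 * exp (- (ln (real N))\<^sup>2) - 2 * real N powr (- \<xi>))"

definition eta :: "real \<Rightarrow> real \<Rightarrow> nat \<Rightarrow> real \<Rightarrow> real" where
  "eta c \<xi> N s =
     8 * exp (- c * (s\<^sup>2 * ln (real N) / real N))
     + 2 * exp (- (ln (real N))\<^sup>2) + 2 * real N powr (- \<xi>)"

text \<open>In the next two definitions \<open>nat\<close> takes the maximum with 0.\<close>

definition T_lower :: "real \<Rightarrow> real \<Rightarrow> nat \<Rightarrow> real \<Rightarrow> nat" where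
  "T_lower K C\<^sub>2 N \<Delta> =
     nat \<lfloor>ln (K * real N / (\<Delta> * sqrt (ln (real N)))) / ln (C\<^sub>2 * sqrt (ln (real N)))\<rfloor>"

definition T_upper :: "real \<Rightarrow> real \<Rightarrow> nat \<Rightarrow> real \<Rightarrow> nat" where
  "T_upper K c\<^sub>1 N \<Delta> =
     nat \<lceil>ln (K * real N / (\<Delta> * sqrt (ln (real N)))) / ln (c\<^sub>1 * sqrt (ln (real N)))\<rceil>"

end

theory Submission
  imports Defs
begin

text \<open>
  Since the graphs are resampled, the process restarts after each day, so one only needs the first
  day of property (A). Write \<open>D = K N / sqrt (ln N)\<close>. If the initial bias is at least \<open>D\<close>, both
  times are 0 and property (B) applies. If it is below \<open>D\<close>, then outside an event of
  probability \<open>2 exp (- x)\<close>, where \<open>x = c \<Delta>\<^sub>0\<^sup>2 ln N / N\<close>, the day-1 bias lies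
  between \<open>c\<^sub>1 sqrt (ln N)\<close> and \<open>C\<^sub>2 sqrt (ln N)\<close> times the old one, which lowers the upper time by at
  least 1 and the lower time by at most 1. Induction on the upper time closes because the square
  of the bias at least doubles: for \<open>x \<ge> 1\<close> one has \<open>2 exp (- x) + 8 exp (- 2 x) \<le> 8 exp (- x)\<close>, so the
  error \<open>eta\<close> absorbs the failure probability of the day. The hypothesis on \<open>h\<close> makes \<open>x\<close> large.
\<close>

section \<open>The normal quantile and positivity of the threshold constant\<close>

lemma std_normal_point_null: "measure std_normal_distribution {z} = 0"
proof -
  have "absolutely_continuous lborel std_normal_distribution"
    by (intro absolutely_continuousI_density) auto
  moreover have "{z} \<in> null_sets lborel"
    by auto
  ultimately have "{z} \<in> null_sets std_normal_distribution"
    unfolding absolutely_continuous_def by blast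
  then show ?thesis by (simp add: null_sets_def measure_def)
qed

text \<open>The density is even and Lebesgue measure is invariant under reflection, so the two
  closed half-lines at 0 have equal mass; the point 0 itself carries none.\<close>

lemma Phi_0: "Phi 0 = 1/2"
proof -
  interpret N: real_distribution std_normal_distribution by (rule real_dist_normal_dist)
  have neg: "distr std_normal_distribution std_normal_distribution uminus = std_normal_distribution"
  proof (rule measure_eqI)
    fix A assume "A \<in> sets (distr std_normal_distribution std_normal_distribution uminus)"
    then have A [measurable]: "A \<in> sets borel" by simp
    then have [measurable]: "uminus -` A \<in> sets borel"
      using measurable_sets[of uminus borel borel A] by simp
    have "emeasure (distr std_normal_distribution std_normal_distribution uminus) A
        = emeasure std_normal_distribution (uminus -` A)"
      by (subst emeasure_distr) auto
    also have "\<dots> = (\<integral>\<^sup>+x. ennreal (std_normal_density x) * indicator (uminus -` A) x \<partial>lborel)"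
      by (subst emeasure_density) (auto)
    also have "\<dots> = (\<integral>\<^sup>+x. ennreal (std_normal_density x) * indicator A x \<partial>lborel)"
      by (subst lborel_distr_uminus[symmetric], subst nn_integral_distr)
        (auto simp: normal_density_def indicator_def intro!: nn_integral_cong)
    also have "\<dots> = emeasure std_normal_distribution A"
      by (subst emeasure_density) auto
    finally show "emeasure (distr std_normal_distribution std_normal_distribution uminus) A
        = emeasure std_normal_distribution A" .
  qed simp
  have "measure std_normal_distribution {..0} = measure std_normal_distribution {0..}"
    by (subst (1) neg[symmetric], subst measure_distr) (auto simp: vimage_def intro!: arg_cong[where f="measure _"])
  moreover have "measure std_normal_distribution {0..} = measure std_normal_distribution {0<..}"
    using N.finite_measure_Union[of "{0}" "{0<..}"] std_normal_point_null
    by (simp add: ivl_disj_un_singleton(1)[of 0, symmetric])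
  moreover have "measure std_normal_distribution {..0} + measure std_normal_distribution {0<..} = 1"
  proof -
    have "{..0} \<union> {0<..} = (UNIV :: real set)" by auto
    then show ?thesis
      using N.finite_measure_Union[of "{..0}" "{0<..}"] N.prob_space by (simp add: disjoint_iff)
  qed
  ultimately show ?thesis
    unfolding Phi_def cdf_def by linarith
qed

text \<open>\<open>inv\<close> returns a true preimage only once one exists: the intermediate value
  theorem supplies it between \<open>Phi 0 = 1/2\<close> and the limit 1 at infinity. Monotonicity
  then excludes preimages \<le> 0.\<close>

lemma inv_Phi_pos:
  assumes "1/2 < x" "x < 1"
  shows "0 < inv Phi x"
proof -
  interpret N: real_distribution std_normal_distribution by (rule real_dist_normal_dist)
  have "isCont Phi z" for z
    unfolding Phi_def by (simp add: N.isCont_cdf std_normal_point_null)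
  moreover have "\<forall>\<^sub>F z in at_top. x < Phi z"
    unfolding Phi_def using N.cdf_lim_at_top_prob assms(2) by (rule order_tendstoD)
  then obtain u where u: "0 \<le> u" "x < Phi u"
    by (auto simp: eventually_at_top_linorder) (meson max.cobounded1 max.cobounded2)
  ultimately obtain z where "Phi z = x"
    using IVT[of Phi 0 x u] assms(1) Phi_0 by auto
  then have "Phi (inv Phi x) = x" by (metis f_inv_into_f rangeI)
  then show ?thesis
    using assms(1) Phi_0 N.cdf_nondecreasing[of "inv Phi x" 0] unfolding Phi_def
    by (metis not_le)
qed

text \<open>Serves to give \<open>K > 0\<close>. From \<open>(b - 1)\<^sup>2 > 0\<close> the point
  \<open>1 - r_star b\<close> lies strictly between 1/2 and 1.\<close>

lemma K2_ER_pos: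
  assumes "1 < b"
  shows "0 < K2_ER b"
proof -
  have "2 * b - 1 < b\<^sup>2"
    using assms zero_less_power2[of "b - 1"] by (simp add: power2_diff)
  then have "sqrt (2 * b - 1) < b"
    using assms by (simp add: real_less_lsqrt)
  then have "0 < r_star b" "r_star b < 1/2"
    using assms by (simp_all add: r_star_def field_simps)
  then show ?thesis
    using assms inv_Phi_pos[of "1 - r_star b"] by (simp add: K2_ER_def)
qed

section \<open>Configurations and the blue time when a first graph is prepended\<close>

lemma finite_configs: "finite (configs N)"
  unfolding configs_def by (intro finite_PiE) auto

lemma update_in_configs:
  assumes "y \<in> configs N"
  shows "update N G y \<in> configs N"
  using assms unfolding configs_def update_def by (auto simp: Let_def PiE_iff)

lemma config_in_configs:
  assumes "y \<in> configs N"
  shows "config N y \<omega> t \<in> configs N"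
  using assms by (induction t) (auto intro: update_in_configs)

lemma bias_eq:
  assumes "y \<in> configs N"
  shows "bias N y = real N - 2 * card (red N y)"
proof -
  have "blue N y \<union> red N y = {1..N}" "blue N y \<inter> red N y = {}"
    using assms by (auto simp: blue_def red_def configs_def PiE_iff)
  then have "card (blue N y) + card (red N y) = N"
    using card_Un_disjoint[of "blue N y" "red N y"]
    by (simp add: blue_def red_def)
  then show ?thesis unfolding bias_def by linarith
qed

lemma red_empty_iff_bias:
  assumes "y \<in> configs N"
  shows "red N y = {} \<longleftrightarrow> bias N y = real N"
  using bias_eq[OF assms] by (simp add: red_def)

text \<open>Pathwise Markov property: the graph \<open>s\<close> is used up on the first day, and
  \<open>\<omega>\<close> then drives the process from the updated configuration.\<close>

lemma config_case_nat_Suc: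
  "config N y (case_nat s \<omega>) (Suc t) = config N (update N s y) \<omega> t"
  by (induction t) auto

lemma blue_time_le: "red N (config N y \<omega> t) = {} \<Longrightarrow> blue_time N y \<omega> \<le> enat t"
  unfolding blue_time_def by (rule Inf_lower) auto

lemma blue_time_eq_0: "red N y = {} \<Longrightarrow> blue_time N y \<omega> = 0"
  using blue_time_le[of N y \<omega> 0] by (simp flip: zero_enat_def)

text \<open>A nonempty set in the well-ordered \<open>enat\<close> attains its infimum; for the
  empty set both sides are infinite.\<close>

lemma eSuc_Inf: "eSuc (Inf A) = Inf (eSuc ` A)"
proof (cases "A = {}")
  case False
  then have "Inf A \<in> A"
    unfolding Inf_enat_def by (auto intro: LeastI)
  then have "Inf (eSuc ` A) \<le> eSuc (Inf A)"
    by (intro Inf_lower imageI)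
  moreover have "eSuc (Inf A) \<le> Inf (eSuc ` A)"
    by (intro Inf_greatest) (auto intro: Inf_lower)
  ultimately show ?thesis by (rule antisym[rotated])
qed (simp add: Inf_enat_def)

text \<open>Restarting on day 1 shifts the clock by one. With unanimity already on day 0 the left
  side would be 0 and the right side positive.\<close>

lemma blue_time_case_nat:
  assumes "red N y \<noteq> {}"
  shows "blue_time N y (case_nat s \<omega>) = eSuc (blue_time N (update N s y) \<omega>)"
proof -
  have "{enat t |t. red N (config N y (case_nat s \<omega>) t) = {}}
      = eSuc ` {enat t |t. red N (config N (update N s y) \<omega> t) = {}}"
  proof (safe, goal_cases)
    case (1 _ t)
    with assms obtain t' where "t = Suc t'" by (cases t) auto
    with 1 show ?case 
      by (auto simp: config_case_nat_Suc simp flip: eSuc_enat simp del: config.simps intro!: imageI)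
  next
    case (2 _ _ t)
    then show ?case
      by (auto simp: config_case_nat_Suc eSuc_enat simp del: config.simps intro!: exI[of _ "Suc t"])
  qed
  then show ?thesis unfolding blue_time_def by (simp add: eSuc_Inf)
qed


section \<open>Measurability and restart of the resampled process\<close>

lemma sequence_space_measure_pmf: "sequence_space (measure_pmf D)"
  by unfold_locales

lemma prob_space_graph_seq: "prob_space (graph_seq N b)"
  unfolding graph_seq_def by (intro prob_space_PiM prob_space_measure_pmf)

lemma space_graph_seq [simp]: "space (graph_seq N b) = UNIV"
  by (simp add: graph_seq_def space_PiM)

lemma measurable_graph_seq_component [measurable]:
  "(\<lambda>\<omega>. \<omega> t) \<in> measurable (graph_seq N b) (count_space UNIV)"
proof -
  have "(\<lambda>\<omega>. \<omega> t) \<in> measurable (graph_seq N b)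
      (measure_pmf (erdos_renyi N (b * ln (real N) / real N)))"
    unfolding graph_seq_def by (rule measurable_component_singleton) simp
  then show ?thesis by simp
qed

text \<open>Only finitely many configurations exist, so a day-\<open>t + 1\<close> event is a finite
  union of day-\<open>t\<close> events intersected with events of one discrete coordinate.
  \<open>P\<close> stays arbitrary since the induction hypothesis is used for equality with
  \<open>z\<close>.\<close>

lemma sets_config:
  assumes "y \<in> configs N"
  shows "{\<omega>. P (config N y \<omega> t)} \<in> sets (graph_seq N b)"
proof (induction t arbitrary: P)
  case 0
  show ?case using sets.top[of "graph_seq N b"] by (cases "P y") auto
next
  case (Suc t)
  have "{\<omega>. P (config N y \<omega> (Suc t))}
      = (\<Union>z\<in>configs N. {\<omega>. config N y \<omega> t = z} \<inter> {\<omega>. P (update N (\<omega> t) z)})"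
    using config_in_configs[OF assms] by auto
  moreover have "{\<omega>. P (update N (\<omega> t) z)} \<in> sets (graph_seq N b)" for z
    using measurable_sets[OF measurable_graph_seq_component, of "{g. P (update N g z)}" t N b]
    by (simp add: vimage_def)
  ultimately show ?case
    using Suc.IH by (auto intro!: sets.finite_UN finite_configs)
qed

lemma blue_time_le_iff:
  "blue_time N y \<omega> \<le> enat n \<longleftrightarrow> (\<exists>t\<le>n. red N (config N y \<omega> t) = {})"
proof
  assume "blue_time N y \<omega> \<le> enat n"
  then have "Inf {enat t |t. red N (config N y \<omega> t) = {}} < enat (Suc n)"
    unfolding blue_time_def by (rule order_le_less_trans) simp
  then show "\<exists>t\<le>n. red N (config N y \<omega> t) = {}"
    unfolding Inf_less_iff by (auto simp: less_Suc_eq_le)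
next
  assume "\<exists>t\<le>n. red N (config N y \<omega> t) = {}"
  then show "blue_time N y \<omega> \<le> enat n"
    using blue_time_le by (meson enat_ord_simps(1) order_trans)
qed

lemma le_blue_time_iff:
  "enat n \<le> blue_time N y \<omega> \<longleftrightarrow> (\<forall>t<n. red N (config N y \<omega> t) \<noteq> {})"
proof -
  have "enat n \<le> blue_time N y \<omega> \<longleftrightarrow> (\<forall>t. red N (config N y \<omega> t) = {} \<longrightarrow> n \<le> t)"
    unfolding blue_time_def le_Inf_iff by (auto simp flip: enat_ord_simps(1))
  then show ?thesis
    unfolding not_less[symmetric] by blast
qed

lemma one_le_blue_time: "red N y \<noteq> {} \<Longrightarrow> enat 1 \<le> blue_time N y \<omega>"
  by (simp add: le_blue_time_iff)

lemma sets_blue_time_window: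
  assumes "y \<in> configs N"
  shows "{\<omega>. enat m \<le> blue_time N y \<omega> \<and> blue_time N y \<omega> \<le> enat n} \<in> sets (graph_seq N b)"
proof -
  have "{\<omega>. enat m \<le> blue_time N y \<omega> \<and> blue_time N y \<omega> \<le> enat n}
      = (UNIV - (\<Union>t<m. {\<omega>. red N (config N y \<omega> t) = {}}))
        \<inter> (\<Union>t\<le>n. {\<omega>. red N (config N y \<omega> t) = {}})"
    by (auto simp: le_blue_time_iff blue_time_le_iff)
  also have "\<dots> \<in> sets (graph_seq N b)"
    using sets.top[of "graph_seq N b"]
    by (intro sets.Int sets.Diff sets.finite_UN)
      (auto intro: sets_config[OF assms, where P = "\<lambda>z. red N z = {}"])
  finally show ?thesis .
qed

text \<open>The i.i.d. law is the image under \<open>case_nat\<close> of the product of one graph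
  law with itself. Integrating over the first graph \<open>s\<close> gives at least
  \<open>(1 - a) * (1 - q)\<close>, which is at least \<open>1 - a - q\<close>.\<close>

lemma prob_first_step_bound:
  fixes a q :: real
  assumes Q: "{\<omega>. Q \<omega>} \<in> sets (graph_seq N b)"
    and step: "\<P>(\<omega> in graph_seq N b. G (\<omega> 0)) \<ge> 1 - a" and "0 \<le> a"
    and rest: "\<And>s. G s \<Longrightarrow> \<P>(\<omega> in graph_seq N b. Q (case_nat s \<omega>)) \<ge> 1 - q" and "0 \<le> q"
  shows "\<P>(\<omega> in graph_seq N b. Q \<omega>) \<ge> 1 - a - q"
proof -
  let ?D = "measure_pmf (erdos_renyi N (b * ln (real N) / real N))"
  let ?M = "graph_seq N b"
  interpret sequence_space ?D
    by (rule sequence_space_measure_pmf)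
  interpret M: prob_space ?M by (rule prob_space_graph_seq)
  have iter: "distr (?D \<Otimes>\<^sub>M ?M) ?M (\<lambda>(s, \<omega>). case_nat s \<omega>) = ?M"
    using PiM_iter by (simp add: graph_seq_def)
  have meas: "(\<lambda>(s, \<omega>). case_nat s \<omega>) \<in> measurable (?D \<Otimes>\<^sub>M ?M) ?M"
    unfolding graph_seq_def by measurable
  \<comment> \<open>The day-1 event depends on coordinate 0 only, so its probability is transferred
    to the law of a single graph.\<close>
  have G: "measure ?D {s. G s} \<ge> 1 - a"
  proof -
    have "distr ?M ?D (\<lambda>\<omega>. \<omega> 0) = ?D"
      using PiM_component[of 0] by (simp add: graph_seq_def)
    then have "measure ?D {s. G s} = measure (distr ?M ?D (\<lambda>\<omega>. \<omega> 0)) {s. G s}"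
      by simp
    also have "\<dots> = measure ?M {\<omega>. G (\<omega> 0)}"
      by (subst measure_distr) (auto simp: vimage_def)
    finally show ?thesis using step by simp
  qed
  show ?thesis
  \<comment> \<open>For \<open>q > 1\<close> the claimed bound is negative; \<open>q \<le> 1\<close>
    keeps the \<open>ennreal\<close> coefficient \<open>1 - q\<close> faithful.\<close>
  proof (cases "q \<le> 1")
    case True
    let ?E = "(\<lambda>(s, \<omega>). case_nat s \<omega>) -` {\<omega>. Q \<omega>} \<inter> space (?D \<Otimes>\<^sub>M ?M)"
    have E: "?E \<in> sets (?D \<Otimes>\<^sub>M ?M)"
      using meas Q by (rule measurable_sets)
    have "ennreal ((1 - q) * measure ?D {s. G s})
        = (\<integral>\<^sup>+s. ennreal (1 - q) * indicator {s. G s} s \<partial>?D)"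
      using True by (simp add: nn_integral_cmult ennreal_mult measure_pmf.emeasure_eq_measure)
    also have "\<dots> \<le> (\<integral>\<^sup>+s. emeasure ?M (Pair s -` ?E) \<partial>?D)"
    proof (intro nn_integral_mono)
      fix s
      have "Pair s -` ?E = {\<omega>. Q (case_nat s \<omega>)}"
        by (auto simp: space_pair_measure)
      then show "ennreal (1 - q) * indicator {s. G s} s \<le> emeasure ?M (Pair s -` ?E)"
        using rest[of s] by (auto simp: indicator_def M.emeasure_eq_measure ennreal_leI)
    qed
    also have "\<dots> = emeasure (?D \<Otimes>\<^sub>M ?M) ?E"
      by (rule M.emeasure_pair_measure_alt[symmetric, OF E])
    also have "\<dots> = emeasure ?M {\<omega>. Q \<omega>}"
      by (subst (2) iter[symmetric], subst emeasure_distr[OF meas Q]) simp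
    finally have "(1 - q) * measure ?D {s. G s} \<le> measure ?M {\<omega>. Q \<omega>}"
      by (simp add: M.emeasure_eq_measure)
    moreover have "(1 - q) * (1 - a) \<le> (1 - q) * measure ?D {s. G s}"
      using G True by (intro mult_left_mono) auto
    moreover have "1 - a - q \<le> (1 - q) * (1 - a)"
      using \<open>0 \<le> a\<close> \<open>0 \<le> q\<close> by (simp add: algebra_simps)
    ultimately show ?thesis by simp
  qed (use \<open>0 \<le> a\<close> in \<open>simp add: order_trans[OF _ measure_nonneg]\<close>)
qed

section \<open>Effect of one day on the two time bounds\<close>

lemma T_upper_T_lower_eq_0:
  assumes "0 < K * real N / sqrt (ln (real N))" "K * real N / sqrt (ln (real N)) \<le> d"
    and "1 < c * sqrt (ln (real N))"
  shows "T_upper K c N d = 0" "T_lower K c N d = 0"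
proof -
  define D where "D = K * real N / sqrt (ln (real N))"
  have D: "K * real N / (d * sqrt (ln (real N))) = D / d"
    by (simp add: D_def field_simps)
  have "ln (D / d) \<le> 0"
    using assms unfolding D_def[symmetric] by simp
  then have "ln (D / d) / ln (c * sqrt (ln (real N))) \<le> 0"
    using assms by (intro divide_nonpos_pos) auto
  then show "T_upper K c N d = 0" "T_lower K c N d = 0"
    unfolding T_upper_def T_lower_def D by (auto simp: ceiling_le_iff floor_le_iff)
qed

text \<open>The upper time is a ceiling of the base-\<open>a\<close> logarithm of
  \<open>D / d\<close>, and growth of \<open>d\<close> by a factor of at least \<open>a\<close>
  takes at least 1 off that logarithm.\<close>

lemma T_upper_step:
  assumes "0 < d" "d < K * real N / sqrt (ln (real N))"
    and "1 < c * sqrt (ln (real N))" "c * sqrt (ln (real N)) * d \<le> d'"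
  shows "T_upper K c N d' + 1 \<le> T_upper K c N d"
proof -
  define D where "D = K * real N / sqrt (ln (real N))"
  define a where "a = c * sqrt (ln (real N))"
  have D: "K * real N / (e * sqrt (ln (real N))) = D / e" for e
    by (simp add: D_def field_simps)
  have *: "0 < d" "d < D" "1 < a" "a * d \<le> d'"
    using assms by (simp_all add: D_def a_def)
  have "0 < a * d" using * by simp
  then have "0 < d'" using * by linarith
  have "D / d' \<le> D / (a * d)"
    using * \<open>0 < d'\<close> by (intro divide_left_mono mult_pos_pos) simp_all
  moreover have "0 < D / d'"
    using *(1,2) \<open>0 < d'\<close> by (intro divide_pos_pos) linarith+
  ultimately have "ln (D / d') \<le> ln (D / (a * d))"
    by simp
  also have "\<dots> = ln (D / d) - ln a"
    using * by (simp add: ln_div ln_mult)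
  finally have "ln (D / d') / ln a \<le> (ln (D / d) - ln a) / ln a"
    using * by (intro divide_right_mono) auto
  also have "\<dots> = ln (D / d) / ln a - 1"
    using * by (simp add: diff_divide_distrib)
  finally have "\<lceil>ln (D / d') / ln a\<rceil> + 1 \<le> \<lceil>ln (D / d) / ln a\<rceil>"
    by linarith
  \<comment> \<open>Since \<open>nat\<close> truncates at 0, a drop by 1 among integers carries over
    to naturals only if the old value is positive; \<open>d < D\<close> ensures this.\<close>
  moreover have "0 < \<lceil>ln (D / d) / ln a\<rceil>"
    using * by simp
  ultimately show ?thesis
    unfolding T_upper_def D a_def[symmetric] by linarith
qed

text \<open>Growth by a factor of at most \<open>a\<close> takes at most 1 off the logarithm, and
  truncation at 0 respects this inequality.\<close>

lemma T_lower_step: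
  assumes "0 < d'" "0 < d" "0 < K * real N / sqrt (ln (real N))"
    and "1 < C * sqrt (ln (real N))" "d' \<le> C * sqrt (ln (real N)) * d"
  shows "T_lower K C N d \<le> T_lower K C N d' + 1"
proof -
  define D where "D = K * real N / sqrt (ln (real N))"
  define a where "a = C * sqrt (ln (real N))"
  have D: "K * real N / (e * sqrt (ln (real N))) = D / e" for e
    by (simp add: D_def field_simps)
  have *: "0 < d" "0 < D" "1 < a" "d' \<le> a * d"
    using assms by (simp_all add: D_def a_def)
  have "ln (D / d) / ln a - 1 = (ln (D / d) - ln a) / ln a"
    using * by (simp add: diff_divide_distrib)
  also have "ln (D / d) - ln a = ln (D / (a * d))"
    using * by (simp add: ln_div ln_mult)
  also have "\<dots> \<le> ln (D / d')"
    using * assms(1) by (subst ln_le_cancel_iff) (auto intro!: divide_left_mono)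
  finally have "ln (D / d) / ln a - 1 \<le> ln (D / d') / ln a"
    using * by (simp add: divide_right_mono)
  then have "\<lfloor>ln (D / d) / ln a\<rfloor> \<le> \<lfloor>ln (D / d') / ln a\<rfloor> + 1"
    by linarith
  then show ?thesis
    unfolding T_lower_def D a_def[symmetric] by linarith
qed

text \<open>If one day of maximal growth passes the threshold, the logarithm is below 1. This covers
  unanimity already on day 1.\<close>

lemma T_lower_eq_0:
  assumes "0 < d" "0 < K * real N / sqrt (ln (real N))" "1 < C * sqrt (ln (real N))"
    and "K * real N / sqrt (ln (real N)) < C * sqrt (ln (real N)) * d"
  shows "T_lower K C N d = 0"
proof -
  define D where "D = K * real N / sqrt (ln (real N))"
  define a where "a = C * sqrt (ln (real N))"
  have D: "K * real N / (d * sqrt (ln (real N))) = D / d"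
    by (simp add: D_def field_simps)
  have *: "0 < d" "0 < D" "1 < a" "D < a * d"
    using assms by (simp_all add: D_def a_def)
  then have "ln (D / d) < ln a"
    by (subst ln_less_cancel_iff) (auto simp: field_simps)
  then have "ln (D / d) / ln a < 1"
    using * by simp
  then show ?thesis
    unfolding T_lower_def D a_def[symmetric] by linarith
qed


section \<open>The error budget and the induction over days\<close>

lemma eta_nonneg: "0 \<le> eta c \<xi> N s"
  unfolding eta_def by (intro add_nonneg_nonneg) auto

text \<open>As \<open>exp (- x) \<le> 1 / 2\<close>, the new term \<open>8 * exp (- 2 * x)\<close>
  is at most \<open>4 * exp (- x)\<close>; with the day's \<open>2 * exp (- x)\<close> this makes 6
  out of the available 8. The other terms of \<open>eta\<close> do not depend on
  \<open>s\<close>.\<close>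

lemma eta_step:
  assumes "1 \<le> c * (s\<^sup>2 * ln (real N) / real N)" "2 * s\<^sup>2 \<le> s'\<^sup>2" "0 < c" "1 \<le> ln (real N)"
  shows "2 * exp (- c * (s\<^sup>2 * ln (real N) / real N)) + eta c \<xi> N s' \<le> eta c \<xi> N s"
proof -
  define x where "x = c * (s\<^sup>2 * ln (real N) / real N)"
  have "c * (2 * s\<^sup>2 * ln (real N) / real N) \<le> c * (s'\<^sup>2 * ln (real N) / real N)"
    using assms by (intro mult_left_mono divide_right_mono mult_right_mono) auto
  then have "2 * x \<le> c * (s'\<^sup>2 * ln (real N) / real N)"
    by (simp add: x_def algebra_simps)
  then have "exp (- (c * (s'\<^sup>2 * ln (real N) / real N))) \<le> exp (- x) * exp (- x)"
    by (simp flip: exp_add)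
  also have "\<dots> \<le> exp (- x) * (1 / 2)"
  proof (intro mult_left_mono)
    have "2 \<le> exp x" using exp_ge_add_one_self[of x] assms(1)[folded x_def] by linarith
    then show "exp (- x) \<le> 1 / 2" by (simp add: exp_minus field_simps)
  qed simp
  finally have "8 * exp (- (c * (s'\<^sup>2 * ln (real N) / real N))) + 2 * exp (- x) \<le> 8 * exp (- x)"
    using exp_gt_zero[of "- x"] by linarith
  then show ?thesis
    by (simp add: eta_def x_def)
qed

text \<open>On day 0 the conditioning event is the whole space, so the conditional bound is a plain
  bound over the first graph.\<close>

lemma cond_prob_first_day:
  assumes "y \<in> configs N"
    and "\<P>(\<omega> in graph_seq N b. P (config N y \<omega> 0) (config N y \<omega> (0 + 1)) \<bar> config N y \<omega> 0 = y) \<ge> r"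
  shows "\<P>(\<omega> in graph_seq N b. P y (update N (\<omega> 0) y)) \<ge> r"
proof -
  interpret prob_space "graph_seq N b" by (rule prob_space_graph_seq)
  show ?thesis
    using assms(2) prob_space by (simp add: cond_prob_def)
qed

text \<open>Here \<open>N\<close> is fixed, and \<open>A\<close> and \<open>B\<close> hold for every
  starting configuration, so they apply afresh after each restart. Both conditions in
  \<open>low\<close> are preserved when the bias increases.\<close>

lemma blue_time_window:
  fixes K c\<^sub>1 C\<^sub>2 c \<xi> b :: real and N :: nat
  defines "L \<equiv> sqrt (ln (real N))"
  assumes K: "0 < K" "K < L" and c: "0 < c" and L: "1 \<le> L" and N: "0 < N"
    and growth: "2 \<le> (c\<^sub>1 * L)\<^sup>2" "0 < c\<^sub>1" "1 < C\<^sub>2 * L"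
    and A: "\<And>z. z \<in> configs N \<Longrightarrow> sqrt (real N / ln (real N)) \<le> bias N z \<Longrightarrow>
       bias N z \<le> K * real N / L \<Longrightarrow>
       \<P>(\<omega> in graph_seq N b.
           c\<^sub>1 * L * bias N z \<le> bias N (update N (\<omega> 0) z) \<and>
           bias N (update N (\<omega> 0) z) \<le> C\<^sub>2 * L * bias N z)
       \<ge> 1 - 2 * exp (- c * ((bias N z)\<^sup>2 * ln (real N) / real N))"
    and B: "\<And>z. z \<in> configs N \<Longrightarrow> K * real N / L \<le> bias N z \<Longrightarrow>
       \<P>(\<omega> in graph_seq N b. red N (config N z \<omega> 2) = {})
       \<ge> 1 - 2 * exp (- (ln (real N))\<^sup>2) - 2 * real N powr (- \<xi>)"
    and y: "y \<in> configs N" "red N y \<noteq> {}"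
    and low: "sqrt (real N / ln (real N)) \<le> bias N y"
      "1 \<le> c * ((bias N y)\<^sup>2 * ln (real N) / real N)"
  shows "\<P>(\<omega> in graph_seq N b.
            enat (T_lower K C\<^sub>2 N (bias N y) + 1) \<le> blue_time N y \<omega> \<and>
            blue_time N y \<omega> \<le> enat (T_upper K c\<^sub>1 N (bias N y) + 2))
         \<ge> 1 - eta c \<xi> N (bias N y)"
  using y low
proof (induction "T_upper K c\<^sub>1 N (bias N y)" arbitrary: y rule: less_induct)
  case less
  interpret prob_space "graph_seq N b" by (rule prob_space_graph_seq)
  let ?d = "bias N y" and ?D = "K * real N / L"
  let ?W = "\<lambda>y \<omega>. enat (T_lower K C\<^sub>2 N (bias N y) + 1) \<le> blue_time N y \<omega> \<and>
            blue_time N y \<omega> \<le> enat (T_upper K c\<^sub>1 N (bias N y) + 2)"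
  have lnN: "1 \<le> ln (real N)" using L by (simp add: L_def)
  have "1 < c\<^sub>1 * L"
  proof (rule ccontr)
    assume "\<not> 1 < c\<^sub>1 * L"
    then have "(c\<^sub>1 * L)\<^sup>2 \<le> 1"
      using growth(2) L by (intro power_le_one) auto
    then show False using growth(1) by simp
  qed
  \<comment> \<open>\<open>K < L\<close> puts the threshold below \<open>N\<close>, the bias of a
    unanimous blue configuration.\<close>
  have D: "0 < ?D" "?D < real N"
    using K N L by (auto simp: field_simps)
  have "0 < real N / ln (real N)" using N lnN by (intro divide_pos_pos) linarith+
  then have "0 < sqrt (real N / ln (real N))" by simp
  then have d: "0 < ?d" using less.prems(3) by linarith
  show ?case
  proof (cases "?D \<le> ?d")
    case True
    have T: "T_lower K C\<^sub>2 N ?d = 0" "T_upper K c\<^sub>1 N ?d = 0"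
      using T_upper_T_lower_eq_0[of K N ?d C\<^sub>2] T_upper_T_lower_eq_0[of K N ?d c\<^sub>1] D True growth(3) \<open>1 < c\<^sub>1 * L\<close>
      by (simp_all add: L_def)
    \<comment> \<open>The window is now day 1 to day 2: red vertices at the start give the lower
      end, \<open>B\<close> gives the upper end.\<close>
    have "1 - eta c \<xi> N ?d \<le> \<P>(\<omega> in graph_seq N b. red N (config N y \<omega> 2) = {})"
      using B[OF less.prems(1) True] exp_gt_zero[of "- c * (?d\<^sup>2 * ln (real N) / real N)"]
      unfolding eta_def by linarith
    also have "\<dots> \<le> prob {\<omega>. ?W y \<omega>}"
    proof (intro finite_measure_mono sets_blue_time_window less.prems)
      show "{\<omega> \<in> space (graph_seq N b). red N (config N y \<omega> 2) = {}} \<subseteq> {\<omega>. ?W y \<omega>}"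
        using one_le_blue_time[OF less.prems(2)] blue_time_le[of N y _ 2]
        unfolding T add_0 by blast
    qed
    finally show ?thesis by simp
  next
    case False
    let ?G = "\<lambda>s. c\<^sub>1 * L * ?d \<le> bias N (update N s y) \<and> bias N (update N s y) \<le> C\<^sub>2 * L * ?d"
    let ?f = "2 * exp (- c * (?d\<^sup>2 * ln (real N) / real N))"
    \<comment> \<open>After the day's failure probability \<open>?f\<close> is paid,
      \<open>eta c \<xi> N ?d - ?f\<close> is the budget left for the restarted process.\<close>
    have rest: "1 - (eta c \<xi> N ?d - ?f) \<le> \<P>(\<omega> in graph_seq N b. ?W y (case_nat s \<omega>))"
      if G: "?G s" for s
    proof -
      define z where "z = update N s y"
      have z: "z \<in> configs N" "c\<^sub>1 * L * ?d \<le> bias N z" "bias N z \<le> C\<^sub>2 * L * ?d"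
        using G update_in_configs[OF less.prems(1)] by (simp_all add: z_def)
      have "1 * ?d \<le> c\<^sub>1 * L * ?d"
        using \<open>1 < c\<^sub>1 * L\<close> d by (intro mult_right_mono) auto
      then have dz: "?d \<le> bias N z" using z by linarith
      have "2 * ?d\<^sup>2 \<le> (c\<^sub>1 * L)\<^sup>2 * ?d\<^sup>2"
        using growth(1) by (intro mult_right_mono) auto
      also have "\<dots> \<le> (bias N z)\<^sup>2"
        unfolding power_mult_distrib[symmetric] using z(2) d growth L by (intro power_mono) auto
      finally have sq: "2 * ?d\<^sup>2 \<le> (bias N z)\<^sup>2" .
      have eta: "?f + eta c \<xi> N (bias N z) \<le> eta c \<xi> N ?d"
        by (rule eta_step[OF less.prems(4) sq c lnN])
      have bt: "blue_time N y (case_nat s \<omega>) = eSuc (blue_time N z \<omega>)" for \<omega>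
        unfolding z_def by (rule blue_time_case_nat[OF less.prems(2)])
      \<comment> \<open>This strict drop both drives the induction and pays for the elapsed day in
        the upper bound.\<close>
      have up: "T_upper K c\<^sub>1 N (bias N z) + 1 \<le> T_upper K c\<^sub>1 N ?d"
        using T_upper_step[of ?d K N c\<^sub>1 "bias N z"] d False \<open>1 < c\<^sub>1 * L\<close> z(2) by (simp add: L_def)
      show ?thesis
      proof (cases "red N z = {}")
        case True
        txt \<open>The lower bound survives unanimity at day 1: it forces \<open>C\<^sub>2 L d \<ge> N\<close>,
          above the threshold, so \<open>T_lower\<close> vanishes.\<close>
        then have "?D < C\<^sub>2 * L * ?d"
          using red_empty_iff_bias[OF z(1)] z(3) D by linarith
        then have "T_lower K C\<^sub>2 N ?d = 0"
          using T_lower_eq_0[of ?d K N C\<^sub>2] d D growth(3) by (simp add: L_def)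
        \<comment> \<open>The blue time is exactly 1, the lower end of a window whose upper end is
          at least 2.\<close>
        then have "?W y (case_nat s \<omega>)" for \<omega>
          using blue_time_eq_0[OF True, of \<omega>] by (simp add: bt one_enat_def eSuc_enat zero_enat_def)
        then show ?thesis
          using eta_nonneg[of c \<xi> N "bias N z"] eta prob_space by simp
      next
        case False
        have "1 - eta c \<xi> N (bias N z) \<le> \<P>(\<omega> in graph_seq N b. ?W z \<omega>)"
        proof (rule less.hyps[OF _ z(1) False])
          show "T_upper K c\<^sub>1 N (bias N z) < T_upper K c\<^sub>1 N ?d" using up by linarith
          show "sqrt (real N / ln (real N)) \<le> bias N z" using less.prems(3) dz by linarith
          have "c * (?d\<^sup>2 * ln (real N) / real N) \<le> c * ((bias N z)\<^sup>2 * ln (real N) / real N)"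
            using c lnN dz d by (intro mult_left_mono divide_right_mono mult_right_mono power_mono) auto
          then show "1 \<le> c * ((bias N z)\<^sup>2 * ln (real N) / real N)" using less.prems(4) by linarith
        qed
        also have "\<dots> \<le> \<P>(\<omega> in graph_seq N b. ?W y (case_nat s \<omega>))"
        proof -
          have "T_lower K C\<^sub>2 N ?d \<le> T_lower K C\<^sub>2 N (bias N z) + 1"
            using T_lower_step[of "bias N z" ?d K N C\<^sub>2] d dz D growth(3) z(3) by (simp add: L_def)
          \<comment> \<open>Removing the elapsed day turns the offsets 1 and 2 of the window into 0
            and 1, which the bounds on \<open>T_lower\<close> and \<open>T_upper\<close> for
            \<open>z\<close> match.\<close>
          moreover have W: "?W y (case_nat s \<omega>) \<longleftrightarrow> enat (T_lower K C\<^sub>2 N ?d) \<le> blue_time N z \<omega>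
              \<and> blue_time N z \<omega> \<le> enat (T_upper K c\<^sub>1 N ?d + 1)" for \<omega>
            unfolding bt by (cases "blue_time N z \<omega>") (auto simp: eSuc_enat)
          ultimately have "?W y (case_nat s \<omega>)" if "?W z \<omega>" for \<omega>
            using that up unfolding W by (cases "blue_time N z \<omega>") auto
          moreover have "{\<omega>. ?W y (case_nat s \<omega>)} \<in> events"
            unfolding W by (rule sets_blue_time_window[OF z(1)])
          ultimately show ?thesis
            by (intro finite_measure_mono) auto
        qed
        finally show ?thesis using eta by linarith
      qed
    qed
    have "1 - ?f - (eta c \<xi> N ?d - ?f) \<le> \<P>(\<omega> in graph_seq N b. ?W y \<omega>)"
    proof (rule prob_first_step_bound[where G = ?G and Q = "?W y", OF _ _ _ rest])
      show "1 - ?f \<le> \<P>(\<omega> in graph_seq N b. ?G (\<omega> 0))"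
        using A[OF less.prems(1,3)] False by simp
      show "0 \<le> eta c \<xi> N ?d - ?f"
        unfolding eta_def by simp
    qed (auto intro: sets_blue_time_window less.prems)
    then show ?thesis by simp
  qed
qed

section \<open>Choice of large \<open>N\<close>, uniformly in the initial configuration\<close>

theorem theorem1p5:
  fixes b K c\<^sub>1 C\<^sub>2 c \<xi> :: real and h :: "nat \<Rightarrow> real"
  assumes "b > 1"
    and "K > K2_ER b"
    and "c\<^sub>1 > 0" and "C\<^sub>2 > 0" and "c > 0" and "\<xi> > 0"
    and "stepwise_amplification b K c\<^sub>1 C\<^sub>2 c"
    and "two_day_unanimity b K \<xi>"
    and "\<And>N. N \<ge> 1 \<Longrightarrow> 1 \<le> h N"
    and "h \<in> o(\<lambda>N. sqrt (ln (real N)))"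
  shows "\<forall>\<^sub>F N in sequentially. \<forall>y\<^sub>0 \<in> configs N.
           red N y\<^sub>0 \<noteq> {} \<longrightarrow> bias N y\<^sub>0 \<ge> sqrt (real N) / h N \<longrightarrow>
           \<P>(\<omega> in graph_seq N b.
               enat (T_lower K C\<^sub>2 N (bias N y\<^sub>0) + 1) \<le> blue_time N y\<^sub>0 \<omega> \<and>
               blue_time N y\<^sub>0 \<omega> \<le> enat (T_upper K c\<^sub>1 N (bias N y\<^sub>0) + 2))
           \<ge> 1 - eta c \<xi> N (bias N y\<^sub>0)"
proof -
  have K: "0 < K" using K2_ER_pos[OF assms(1)] assms(2) by linarith
  \<comment> \<open>With \<open>h N \<le> r * L\<close> the bias is at least
    \<open>sqrt N / (r * L)\<close>. Then \<open>r \<le> 1\<close> yields the lower threshold of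
    property (A), and \<open>r\<^sup>2 \<le> c\<close> makes the exponent at least 1.\<close>
  define r where "r = min 1 (sqrt c)"
  have r: "0 < r" "r \<le> 1" "r\<^sup>2 \<le> c"
    using \<open>c > 0\<close> by (auto simp: r_def min_def real_le_rsqrt power_le_one real_sqrt_le_iff)
  have lim: "filterlim (\<lambda>N. sqrt (ln (real N))) at_top sequentially"
    by (intro filterlim_compose[OF sqrt_at_top] filterlim_compose[OF ln_at_top] filterlim_real_sequentially)
  \<comment> \<open>\<open>K + 1\<close> forces \<open>K < L\<close>; the quotients by
    \<open>c\<^sub>1\<close> and \<open>C\<^sub>2\<close> make both growth factors at least
    2.\<close>
  have "\<forall>\<^sub>F N in sequentially. max (max (K + 1) 1) (max (2 / c\<^sub>1) (2 / C\<^sub>2)) \<le> sqrt (ln (real N))"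
    using lim unfolding filterlim_at_top by blast
  moreover have "\<forall>\<^sub>F N in sequentially. norm (h N) \<le> r * norm (sqrt (ln (real N)))"
    using landau_o.smallD[OF assms(10) r(1)] .
  moreover note assms(7)[unfolded stepwise_amplification_def] assms(8)[unfolded two_day_unanimity_def]
    eventually_ge_at_top[of "1::nat"]
  ultimately show ?thesis
  proof eventually_elim
    case (elim N)
    define L where "L = sqrt (ln (real N))"
    have L: "K < L" "1 \<le> L" "2 \<le> c\<^sub>1 * L" "2 \<le> C\<^sub>2 * L"
      using elim(1) assms(3,4) by (auto simp: L_def[symmetric] field_simps)
    have lnN: "ln (real N) = L\<^sup>2" "1 \<le> ln (real N)"
      using L(2) by (auto simp: L_def)
    have h: "1 \<le> h N" "h N \<le> r * L"
      using assms(9)[OF elim(5)] elim(2) L(2) by (auto simp: L_def)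
    show ?case
    proof (intro ballI impI)
      fix y assume y: "y \<in> configs N" "red N y \<noteq> {}" "sqrt (real N) / h N \<le> bias N y"
      have "sqrt (real N) / (r * L) \<le> sqrt (real N) / h N"
        using h by (intro divide_left_mono) auto
      then have low: "sqrt (real N) / (r * L) \<le> bias N y" using y(3) by linarith
      have "sqrt (real N) / L \<le> sqrt (real N) / (r * L)"
        using r L(2) by (intro divide_left_mono) auto
      then have low1: "sqrt (real N / ln (real N)) \<le> bias N y"
        using low by (simp add: real_sqrt_divide L_def)
      have "1 \<le> bias N y * (r * L) / sqrt (real N)"
        using low r L(2) elim(5) by (simp add: field_simps)
      then have "1 \<le> (bias N y * (r * L) / sqrt (real N))\<^sup>2"
        by (rule one_le_power)
      also have "\<dots> = r\<^sup>2 * ((bias N y)\<^sup>2 * L\<^sup>2 / real N)"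
        by (simp add: power_mult_distrib power_divide)
      also have "\<dots> \<le> c * ((bias N y)\<^sup>2 * L\<^sup>2 / real N)"
        using r(3) by (intro mult_right_mono) auto
      finally have low2: "1 \<le> c * ((bias N y)\<^sup>2 * ln (real N) / real N)"
        by (simp add: lnN)
      have "2\<^sup>2 \<le> (c\<^sub>1 * L)\<^sup>2" using L(3) by (intro power_mono) auto
      then have growth: "2 \<le> (c\<^sub>1 * L)\<^sup>2" by simp
      interpret prob_space "graph_seq N b" by (rule prob_space_graph_seq)
      show "\<P>(\<omega> in graph_seq N b.
               enat (T_lower K C\<^sub>2 N (bias N y) + 1) \<le> blue_time N y \<omega> \<and>
               blue_time N y \<omega> \<le> enat (T_upper K c\<^sub>1 N (bias N y) + 2))
           \<ge> 1 - eta c \<xi> N (bias N y)"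
      proof (rule blue_time_window[of K N c c\<^sub>1 C\<^sub>2 b \<xi> y])
        fix z assume z: "z \<in> configs N" "sqrt (real N / ln (real N)) \<le> bias N z"
          "bias N z \<le> K * real N / sqrt (ln (real N))"
        \<comment> \<open>Property (A) is used with \<open>z\<close> as the initial configuration
          and \<open>t = 0\<close>, where its positivity condition holds with probability 1.\<close>
        have "prob {\<omega> \<in> space (graph_seq N b). config N z \<omega> 0 = z} > 0"
          using prob_space by simp
        then show "\<P>(\<omega> in graph_seq N b.
           c\<^sub>1 * sqrt (ln (real N)) * bias N z \<le> bias N (update N (\<omega> 0) z) \<and>
           bias N (update N (\<omega> 0) z) \<le> C\<^sub>2 * sqrt (ln (real N)) * bias N z)
          \<ge> 1 - 2 * exp (- c * ((bias N z)\<^sup>2 * ln (real N) / real N))"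
          using elim(3) z by (intro cond_prob_first_day[OF z(1)]) blast
      qed (use K L growth low1 low2 y elim(4,5) assms(3,5) in \<open>auto simp: L_def\<close>)
    qed
  qed
qed

end
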